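(* Let $\alpha\in(0,1)$ be irrational and let $s_\alpha$ be a Sturmian word of angle $\alpha$. The following are equivalent: \begin{enumerate} \item[(i)] $A(s_\alpha)$ is finite; \item[(ii)] $s_\alpha$ is $\beta$-power-free for some real number $\beta\geq2$; \item[(iii)] $\alpha$ has bounded partial quotients. \end{enumerate}
   Context: $\{x\}=x-\lfloor x\rfloor$ is the fractional part. For irrational $\alpha\in(0,1)$ and $\rho\in[0,1)$, a Sturmian word of angle $\alpha$ and initial point $\rho$ is the infinite word $c_0c_1c_2\cdots$ over $\{a,b\}$ with $c_n=b$ if $\{\rho+n\alpha\}\in I_b$ and $c_n=a$ if $\{\rho+n\alpha\}\in I_a$, where either $I_b=[0,1-\alpha)$, $I_a=[1-\alpha,1)$, or $I_b=(0,1-\alpha]$, $I_a=(1-\alpha,1]$ with $0$ identified with $1$. $s_\alpha$ denotes any Sturmian word of angle $\alpha$. The Parikh vector $\mathcal{P}$ of a word over $\{a,b\}$ is the pair (number of $a$'s, number of $b$'s), with norm $|\mathcal P|$ the sum of its components. $\mathcal{P}$ is contained in $\mathcal{Q}$ if $|\mathcal P|<|\mathcal Q|$ and $\mathcal P\leq\mathcal Q$ componentwise. A word $w$ is an abelian power of period $m$ and exponent $k$ if $w=u_1\cdots u_k$ where all $u_i$ have length $m$ and the same Parikh vector. A word $w$ is an abelian repetition of period $m$ and exponent $|w|/m$ if $w=u_0u_1\cdots u_{j-1}u_j$ with $j\geq3$, where $u_1,\dots,u_{j-1}$ have length $m$ and the same Parikh vector $\mathcal P$, and the Parikh vectors of $u_0$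 and $u_j$ (possibly empty words) are contained in $\mathcal P$. For $m>1$ let $k_m$ (resp. $k'_m$) be the maximum exponent of an abelian power (resp. abelian repetition) of period $m$ that is a factor of $s_\alpha$. The abelian critical exponent of $s_\alpha$ is $A(s_\alpha)=\limsup_{m\to\infty}k_m/m=\limsup_{m\to\infty}k'_m/m\in[0,\infty]$ (the two coincide since $k_m\leq k'_m<k_m+2$). A word $w$ has (ordinary) period $p>0$ if $w_i=w_{i+p}$ for all $1\leq i\leq|w|-p$; its exponent is $|w|$ divided by its minimum period. An infinite word is $\beta$-power-free if it has no factor of exponent $\beta$ or larger. $\alpha=[a_0;a_1,a_2,\ldots]$ has bounded partial quotients if the sequence $(a_i)$ of its continued fraction partial quotients is bounded. *)

theory Defs
  imports "HOL-Analysis.Analysis"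
begin

section \<open>Sturmian words\<close>

datatype letter = La | Lb

definition sturmian_left :: "real \<Rightarrow> real \<Rightarrow> nat \<Rightarrow> letter" where
  "sturmian_left \<alpha> \<rho> n = (if frac (\<rho> + real n * \<alpha>) \<in> {0..<1 - \<alpha>} then Lb else La)"

text \<open>Here the interval coding the other letter is \<open>(1 - \<alpha>, 1]\<close>, where \<open>1\<close> is
  identified with \<open>0\<close>; so a point with fractional part \<open>0\<close> is coded by \<^const>\<open>La\<close>.\<close>

definition sturmian_right :: "real \<Rightarrow> real \<Rightarrow> nat \<Rightarrow> letter" where
  "sturmian_right \<alpha> \<rho> n = (if frac (\<rho> + real n * \<alpha>) \<in> {0<..1 - \<alpha>} then Lb else La)"

definition sturmian_word :: "real \<Rightarrow> (nat \<Rightarrow> letter) \<Rightarrow> bool" where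
  "sturmian_word \<alpha> s \<longleftrightarrow>
     (\<exists>\<rho>. 0 \<le> \<rho> \<and> \<rho> < 1 \<and> (s = sturmian_left \<alpha> \<rho> \<or> s = sturmian_right \<alpha> \<rho>))"

definition factor :: "'a list \<Rightarrow> (nat \<Rightarrow> 'a) \<Rightarrow> bool" where
  "factor w s \<longleftrightarrow> (\<exists>i. w = map s [i..<i + length w])"

section \<open>Abelian powers and repetitions\<close>

definition parikh :: "letter list \<Rightarrow> nat \<times> nat" where
  "parikh w = (count_list w La, count_list w Lb)"

definition parikh_norm :: "nat \<times> nat \<Rightarrow> nat" where
  "parikh_norm P = fst P + snd P"

definition parikh_contained :: "nat \<times> nat \<Rightarrow> nat \<times> nat \<Rightarrow> bool" where
  "parikh_contained P Q \<longleftrightarrow>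
     parikh_norm P < parikh_norm Q \<and> fst P \<le> fst Q \<and> snd P \<le> snd Q"

definition abelian_power :: "nat \<Rightarrow> nat \<Rightarrow> letter list \<Rightarrow> bool" where
  "abelian_power m k w \<longleftrightarrow> m > 0 \<and> k > 0 \<and>
     (\<exists>us P. w = concat us \<and> length us = k \<and> (\<forall>u\<in>set us. length u = m \<and> parikh u = P))"

text \<open>The list \<open>us\<close> holds the full blocks \<open>u\<^sub>1, \<dots>, u\<^bsub>j-1\<^esub>\<close> with \<open>j \<ge> 3\<close>; the exponent is
  \<open>real (length w) / real m\<close>.\<close>

definition abelian_repetition :: "nat \<Rightarrow> letter list \<Rightarrow> bool" where
  "abelian_repetition m w \<longleftrightarrow> m > 0 \<and>
     (\<exists>u0 us uj P. w = u0 @ concat us @ uj \<and> length us \<ge> 2 \<and>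
        (\<forall>u\<in>set us. length u = m \<and> parikh u = P) \<and>
        parikh_contained (parikh u0) P \<and> parikh_contained (parikh uj) P)"

text \<open>The maximal exponents are taken as suprema in \<open>[0, \<infinity>]\<close>, which equal the maxima
  whenever these exist, as they do for Sturmian words.\<close>

definition abelian_power_exp :: "(nat \<Rightarrow> letter) \<Rightarrow> nat \<Rightarrow> ennreal" where
  "abelian_power_exp s m = Sup {of_nat k | k w. factor w s \<and> abelian_power m k w}"

definition abelian_repetition_exp :: "(nat \<Rightarrow> letter) \<Rightarrow> nat \<Rightarrow> ennreal" where
  "abelian_repetition_exp s m =
     Sup {ennreal (real (length w) / real m) | w. factor w s \<and> abelian_repetition m w}"

definition abelian_critical_exponent :: "(nat \<Rightarrow> letter) \<Rightarrow> ennreal" where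
  "abelian_critical_exponent s = limsup (\<lambda>m. abelian_power_exp s m / of_nat m)"

lemma length_eq_parikh_norm: "length w = parikh_norm (parikh w)"
proof (induction w)
  case (Cons x xs)
  then show ?case by (cases x) (auto simp: parikh_def parikh_norm_def)
qed (simp add: parikh_def parikh_norm_def)

lemma factor_appendD:
  assumes "factor (u @ v @ w) s" shows "factor v s"
proof -
  obtain i where i: "u @ v @ w = map s [i..<i + length (u @ v @ w)]"
    using assms unfolding factor_def by blast
  have "v = take (length v) (drop (length u) (u @ v @ w))" by simp
  also have "\<dots> = map s (take (length v) (drop (length u) [i..<i + length (u @ v @ w)]))"
    by (subst i) (simp only: take_map drop_map)
  also have "\<dots> = map s [i + length u..<i + length u + length v]"
    by (simp add: drop_upt take_upt)
  finally show ?thesis unfolding factor_def by blast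
qed

lemma length_concat_const:
  assumes "\<forall>u\<in>set us. length u = m" shows "length (concat us) = length us * m"
  using assms by (induction us) auto

lemma abelian_power_exp_le: "abelian_power_exp s m \<le> abelian_repetition_exp s m + 1"
  unfolding abelian_power_exp_def
proof (rule Sup_least, clarify)
  fix k w assume w: "factor w s" "abelian_power m k w"
  show "of_nat k \<le> abelian_repetition_exp s m + 1"
  proof (cases "k \<ge> 2")
    case True
    obtain us P where us: "w = concat us" "length us = k" "m > 0"
        "\<forall>u\<in>set us. length u = m \<and> parikh u = P"
      using w(2) unfolding abelian_power_def by blast
    obtain u where "u \<in> set us" using us(2) True by (cases us) auto
    then have "parikh_norm P = m" using us(4) length_eq_parikh_norm by metis
    then have "parikh_contained (parikh []) P"
      using us(3) by (simp add: parikh_contained_def parikh_def parikh_norm_def)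
    then have "abelian_repetition m w"
      unfolding abelian_repetition_def using us True
      by (intro conjI exI[of _ "[]"] exI[of _ us] exI[of _ P]) auto
    then have "ennreal (real (length w) / real m) \<le> abelian_repetition_exp s m"
      unfolding abelian_repetition_exp_def using w(1) by (intro Sup_upper) blast
    moreover have "real (length w) / real m = real k"
      using us length_concat_const[of us m] by simp
    ultimately have "of_nat k \<le> abelian_repetition_exp s m"
      by (simp add: ennreal_of_nat_eq_real_of_nat)
    then show ?thesis using add_increasing2 zero_le by blast
  next
    case False
    then have "of_nat k \<le> (of_nat 1 :: ennreal)" by (intro of_nat_mono) simp
    then show ?thesis by (simp add: add_increasing)
  qed
qed

lemma abelian_repetition_exp_le: "abelian_repetition_exp s m \<le> abelian_power_exp s m + 2"
  unfolding abelian_repetition_exp_def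
proof (rule Sup_least, clarify)
  fix w assume w: "factor w s" "abelian_repetition m w"
  obtain u0 us uj P where us: "w = u0 @ concat us @ uj" "length us \<ge> 2" "m > 0"
      "\<forall>u\<in>set us. length u = m \<and> parikh u = P"
      "parikh_contained (parikh u0) P" "parikh_contained (parikh uj) P"
    using w(2) unfolding abelian_repetition_def by blast
  obtain u where "u \<in> set us" using us(2) by (cases us) auto
  then have P: "parikh_norm P = m" using us(4) length_eq_parikh_norm by metis
  have "abelian_power m (length us) (concat us)"
    unfolding abelian_power_def using us by auto
  moreover have "factor (concat us) s" using w(1) us(1) factor_appendD by blast
  ultimately have k: "of_nat (length us) \<le> abelian_power_exp s m"
    unfolding abelian_power_exp_def by (intro Sup_upper) blast
  have "length u0 \<le> m" "length uj \<le> m"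
    using us(5,6) P by (simp_all add: length_eq_parikh_norm parikh_contained_def)
  then have "length w \<le> (length us + 2) * m"
    using us(1,4) length_concat_const[of us m] by (simp add: algebra_simps)
  then have "real (length w) \<le> real (length us + 2) * real m"
    unfolding of_nat_mult[symmetric] of_nat_le_iff .
  then have "real (length w) / real m \<le> real (length us + 2)"
    using us(3) by (simp add: divide_le_eq)
  then have "ennreal (real (length w) / real m) \<le> of_nat (length us + 2)"
    unfolding ennreal_of_nat_eq_real_of_nat by (rule ennreal_leI)
  also have "\<dots> \<le> abelian_power_exp s m + 2" unfolding of_nat_add of_nat_numeral using k by (rule add_right_mono)
  finally show "ennreal (real (length w) / real m) \<le> abelian_power_exp s m + 2" .
qed

lemma limsup_div_nat_mono:
  fixes f g :: "nat \<Rightarrow> ennreal"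
  assumes "\<And>m. f m \<le> g m + of_nat c"
  shows "limsup (\<lambda>m. f m / of_nat m) \<le> limsup (\<lambda>m. g m / of_nat m)"
proof -
  have lim: "(\<lambda>m. of_nat c / of_nat m :: ennreal) \<longlonglongrightarrow> 0"
  proof -
    have "(\<lambda>m. ennreal (real c / real m)) \<longlonglongrightarrow> ennreal 0"
      by (intro tendsto_ennrealI lim_const_over_n)
    moreover have "\<forall>\<^sub>F m in sequentially. ennreal (real c / real m) = of_nat c / of_nat m"
      using eventually_gt_at_top[of 0]
      by eventually_elim (simp add: ennreal_of_nat_eq_real_of_nat divide_ennreal)
    ultimately show ?thesis using Lim_transform_eventually by fastforce
  qed
  show ?thesis
  proof (rule ennreal_le_epsilon)
    fix e :: real assume e: "0 < e"
    have "\<forall>\<^sub>F m in sequentially. of_nat c / of_nat m < ennreal e"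
      using e by (intro order_tendstoD(2)[OF lim]) (simp add: ennreal_less_zero_iff)
    then have "\<forall>\<^sub>F m in sequentially. f m / of_nat m \<le> ennreal e + g m / of_nat m"
    proof eventually_elim
      case (elim m)
      have "f m / of_nat m \<le> (g m + of_nat c) / of_nat m"
        by (intro divide_right_mono_ennreal assms)
      also have "\<dots> = of_nat c / of_nat m + g m / of_nat m"
        by (simp add: add_divide_distrib_ennreal add.commute)
      also have "\<dots> \<le> ennreal e + g m / of_nat m" using elim by (intro add_right_mono) simp
      finally show ?case .
    qed
    then have "limsup (\<lambda>m. f m / of_nat m) \<le> limsup (\<lambda>m. ennreal e + g m / of_nat m)"
      by (rule Limsup_mono)
    also have "\<dots> = ennreal e + limsup (\<lambda>m. g m / of_nat m)"
      by (intro Limsup_const_add) (auto intro: continuous_intros monoI add_left_mono)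
    finally show "limsup (\<lambda>m. f m / of_nat m) \<le> limsup (\<lambda>m. g m / of_nat m) + ennreal e"
      by (simp add: add.commute)
  qed
qed

lemma abelian_critical_exponent_repetition:
  "abelian_critical_exponent s = limsup (\<lambda>m. abelian_repetition_exp s m / of_nat m)"
  unfolding abelian_critical_exponent_def
  using limsup_div_nat_mono[of "abelian_power_exp s" "abelian_repetition_exp s" 1]
    limsup_div_nat_mono[of "abelian_repetition_exp s" "abelian_power_exp s" 2]
    abelian_power_exp_le abelian_repetition_exp_le
  by (intro antisym) auto

section \<open>Ordinary powers\<close>

definition has_period :: "'a list \<Rightarrow> nat \<Rightarrow> bool" where
  "has_period w p \<longleftrightarrow> p > 0 \<and> (\<forall>i. i + p < length w \<longrightarrow> w ! i = w ! (i + p))"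

definition word_exponent :: "'a list \<Rightarrow> real" where
  "word_exponent w = real (length w) / real (LEAST p. has_period w p)"

definition power_free :: "real \<Rightarrow> (nat \<Rightarrow> 'a) \<Rightarrow> bool" where
  "power_free \<beta> s \<longleftrightarrow> (\<forall>w. factor w s \<longrightarrow> word_exponent w < \<beta>)"

section \<open>Continued fractions\<close>

text \<open>For irrational \<open>x\<close> no fractional part below vanishes, so the expansion does not
  terminate.\<close>

primrec complete_quotient :: "real \<Rightarrow> nat \<Rightarrow> real" where
  "complete_quotient x 0 = x"
| "complete_quotient x (Suc n) = 1 / frac (complete_quotient x n)"

definition partial_quotient :: "real \<Rightarrow> nat \<Rightarrow> int" where
  "partial_quotient x n = \<lfloor>complete_quotient x n\<rfloor>"

definition bounded_partial_quotients :: "real \<Rightarrow> bool" where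
  "bounded_partial_quotients x \<longleftrightarrow> (\<exists>B. \<forall>n. \<bar>partial_quotient x n\<bar> \<le> B)"

end

theory Submission
  imports Defs
begin

text \<open>All three conditions are equivalent to \<open>\<alpha>\<close> being badly approximable, i.e. \<open>m * \<bar>m * \<alpha> - p\<bar> \<ge> c > 0\<close> for
  all \<open>m > 0\<close> and \<open>p\<close>. With \<open>G\<close> the floor or the ceiling function, the number of letters \<open>a\<close> in a block is the
  difference of \<open>G\<close> at two points of the orbit \<open>\<rho> + n * \<alpha>\<close>. So abelian powers of period \<open>m\<close> and exponent \<open>k\<close>
  exist essentially when \<open>k * \<bar>m * \<alpha> - p\<bar> < 1\<close> for some \<open>p\<close>, and an ordinary power of period \<open>m\<close> is a stretch of
  the orbit avoiding an interval of length \<open>\<bar>m * \<alpha> - p\<bar>\<close> next to the integers.\<close>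

section \<open>Badly approximable numbers and continued fractions\<close>

definition badly_approximable :: "real \<Rightarrow> bool" where
  "badly_approximable x \<longleftrightarrow>
     (\<exists>c>0. \<forall>m::nat. m > 0 \<longrightarrow> (\<forall>p::int. c \<le> real m * \<bar>real m * x - of_int p\<bar>))"

section \<open>Complete quotients, convergents and their errors\<close>

lemma complete_quotient_irrational: "x \<notin> \<rat> \<Longrightarrow> complete_quotient x n \<notin> \<rat>"
proof (induction n)
  case (Suc n)
  then have "frac (complete_quotient x n) \<notin> \<rat>" by simp
  then show ?case using Rats_divide[OF Rats_1, of "complete_quotient x (Suc n)"] by auto
qed simp

lemma frac_complete_quotient:
  assumes "x \<notin> \<rat>"
  shows "0 < frac (complete_quotient x n)" "frac (complete_quotient x n) < 1"
proof -
  have "frac (complete_quotient x n) \<noteq> 0"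
    using complete_quotient_irrational[OF assms, of n] by (metis Rats_0 frac_in_Rats_iff)
  then show "0 < frac (complete_quotient x n)" using frac_ge_0 by (metis order_le_less)
qed (rule frac_lt_1)

lemma partial_quotient_Suc_ge_1: "x \<notin> \<rat> \<Longrightarrow> 1 \<le> partial_quotient x (Suc n)"
  using frac_complete_quotient[of x n] by (simp add: partial_quotient_def le_floor_iff)

text \<open>Up to sign, \<open>conv_error x n\<close> is \<open>q * x - p\<close> for the convergent \<open>p / q\<close> of index \<open>n - 1\<close>,
  whose denominator \<open>q\<close> is \<open>conv_denom x n\<close>; index \<open>0\<close> stands for the formal convergent \<open>1 / 0\<close>.\<close>

definition conv_error :: "real \<Rightarrow> nat \<Rightarrow> real" where
  "conv_error x n = (\<Prod>i<n. frac (complete_quotient x i))"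

fun conv_denom :: "real \<Rightarrow> nat \<Rightarrow> int" where
  "conv_denom x 0 = 0"
| "conv_denom x (Suc 0) = 1"
| "conv_denom x (Suc (Suc n)) = partial_quotient x (Suc n) * conv_denom x (Suc n) + conv_denom x n"

fun conv_numer :: "real \<Rightarrow> nat \<Rightarrow> int" where
  "conv_numer x 0 = 1"
| "conv_numer x (Suc 0) = partial_quotient x 0"
| "conv_numer x (Suc (Suc n)) = partial_quotient x (Suc n) * conv_numer x (Suc n) + conv_numer x n"

lemma conv_error_Suc: "conv_error x (Suc n) = conv_error x n * frac (complete_quotient x n)"
  by (simp add: conv_error_def)

lemma conv_error_pos: "x \<notin> \<rat> \<Longrightarrow> 0 < conv_error x n"
  unfolding conv_error_def by (intro prod_pos frac_complete_quotient(1))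

lemma conv_error_eq_Suc_mult: "x \<notin> \<rat> \<Longrightarrow> conv_error x n = conv_error x (Suc n) * complete_quotient x (Suc n)"
  using frac_complete_quotient[of x n] by (simp add: conv_error_Suc)

text \<open>The splitting of a complete quotient into integer and fractional part, scaled by
  \<open>conv_error x (Suc n)\<close>: one step of the Euclidean algorithm on the errors.\<close>

lemma conv_error_rec:
  assumes "x \<notin> \<rat>"
  shows "conv_error x n = of_int (partial_quotient x (Suc n)) * conv_error x (Suc n) + conv_error x (Suc (Suc n))"
  unfolding conv_error_eq_Suc_mult[OF assms, of n] conv_error_Suc[of x "Suc n"] partial_quotient_def frac_def
  by (simp add: algebra_simps del: complete_quotient.simps)

text \<open>With alternating signs the errors obey the same two-term recurrence as
  \<open>conv_numer\<close> and \<open>conv_denom\<close>, so only the two initial values have to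
  agree.\<close>

lemma conv_error_signed:
  assumes "x \<notin> \<rat>"
  shows "(-1) ^ n * conv_error x n = of_int (conv_numer x n) - of_int (conv_denom x n) * x"
proof (induction n rule: induct_nat_012)
  case (ge2 n)
  have "(-1) ^ Suc (Suc n) * conv_error x (Suc (Suc n)) =
      (-1) ^ n * conv_error x n + of_int (partial_quotient x (Suc n)) * ((-1) ^ Suc n * conv_error x (Suc n))"
    using conv_error_rec[OF assms, of n] by (simp add: algebra_simps)
  also have "\<dots> = of_int (conv_numer x (Suc (Suc n))) - of_int (conv_denom x (Suc (Suc n))) * x"
    unfolding ge2 by (simp add: algebra_simps)
  finally show ?case .
qed (auto simp: conv_error_def partial_quotient_def frac_def)

lemma abs_conv_error:
  assumes "x \<notin> \<rat>"
  shows "\<bar>of_int (conv_denom x n) * x - of_int (conv_numer x n)\<bar> = conv_error x n"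
proof -
  have "\<bar>of_int (conv_denom x n) * x - of_int (conv_numer x n)\<bar> = \<bar>(-1) ^ n * conv_error x n\<bar>"
    unfolding conv_error_signed[OF assms] by (rule abs_minus_commute)
  then show ?thesis using conv_error_pos[OF assms, of n] by (simp add: abs_mult)
qed

lemma conv_denom_bounds:
  assumes "x \<notin> \<rat>"
  shows "0 \<le> conv_denom x n \<and> 1 \<le> conv_denom x (Suc n)"
proof (induction n)
  case (Suc n)
  have "1 * 1 \<le> partial_quotient x (Suc n) * conv_denom x (Suc n)"
    using Suc partial_quotient_Suc_ge_1[OF assms, of n] by (intro mult_mono) auto
  then show ?case using Suc by simp
qed simp

text \<open>The determinant identity for consecutive convergents, written with errors: by
  \<open>conv_error_rec\<close> the left-hand side does not change from \<open>n\<close> to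
  \<open>Suc n\<close>.\<close>

lemma conv_wronskian:
  assumes "x \<notin> \<rat>"
  shows "of_int (conv_denom x (Suc n)) * conv_error x n + of_int (conv_denom x n) * conv_error x (Suc n) = 1"
proof (induction n)
  case (Suc n)
  show ?case using Suc unfolding conv_error_rec[OF assms, of n] by (simp add: algebra_simps)
qed (simp add: conv_error_def)

lemma conv_denom_error_le_1:
  assumes "x \<notin> \<rat>"
  shows "of_int (conv_denom x (Suc n)) * conv_error x n \<le> 1"
proof -
  have "0 \<le> of_int (conv_denom x n) * conv_error x (Suc n)"
    using conv_denom_bounds[OF assms, of n] conv_error_pos[OF assms, of "Suc n"] by simp
  then show ?thesis using conv_wronskian[OF assms, of n] by linarith
qed

text \<open>Errors decrease and partial quotients are at least 1, so \<open>conv_error_rec\<close>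
  halves the error every two steps. This makes arbitrarily small errors available.\<close>

lemma conv_error_even_le:
  assumes "x \<notin> \<rat>"
  shows "conv_error x (2 * n) \<le> (1 / 2) ^ n"
proof (induction n)
  case (Suc n)
  have "conv_error x (Suc (2 * n)) \<le> of_int (partial_quotient x (Suc (2 * n))) * conv_error x (Suc (2 * n))"
    using partial_quotient_Suc_ge_1[OF assms, of "2 * n"] conv_error_pos[OF assms, of "Suc (2 * n)"]
    by simp
  moreover have "conv_error x (Suc (Suc (2 * n))) \<le> conv_error x (Suc (2 * n))"
    unfolding conv_error_Suc[of x "Suc (2 * n)"]
    using frac_lt_1[of "complete_quotient x (Suc (2 * n))"] conv_error_pos[OF assms, of "Suc (2 * n)"]
    by (intro mult_right_le_one_le) (auto intro: frac_ge_0)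
  ultimately have "2 * conv_error x (2 * Suc n) \<le> conv_error x (2 * n)"
    using conv_error_rec[OF assms, of "2 * n"] by simp
  then show ?case using Suc by simp
qed (simp add: conv_error_def)

section \<open>Bounded partial quotients versus bad approximability\<close>

text \<open>The next denominator is at least \<open>a * q\<close> and its product with
  \<open>t\<close> is at most 1, while bad approximability gives \<open>c \<le> q * t\<close>; hence
  \<open>a \<le> 1 / c\<close>.\<close>

lemma bounded_partial_quotients_if_badly_approximable:
  assumes x: "x \<notin> \<rat>" and "badly_approximable x"
  shows "bounded_partial_quotients x"
proof -
  obtain c where c: "c > 0"
    "\<And>(m::nat) (p::int). m > 0 \<Longrightarrow> c \<le> real m * \<bar>real m * x - of_int p\<bar>"
    using assms(2) unfolding badly_approximable_def by blast
  have bound: "\<bar>partial_quotient x (Suc n)\<bar> \<le> \<lceil>1 / c\<rceil>" for n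
  proof -
    define a where "a = real_of_int (partial_quotient x (Suc n))"
    define q where "q = real_of_int (conv_denom x (Suc n))"
    define t where "t = conv_error x (Suc n)"
    have a: "1 \<le> a" using partial_quotient_Suc_ge_1[OF x, of n] by (simp add: a_def)
    have "0 < nat (conv_denom x (Suc n))" using conv_denom_bounds[OF x, of n] by simp
    then have "c \<le> q * t"
      using c(2)[of "nat (conv_denom x (Suc n))" "conv_numer x (Suc n)"]
        abs_conv_error[OF x, of "Suc n"] conv_denom_bounds[OF x, of n]
      by (simp add: q_def t_def)
    then have "a * c \<le> a * q * t" using a by (simp add: mult.assoc)
    also have "\<dots> \<le> real_of_int (conv_denom x (Suc (Suc n))) * t"
      using conv_denom_bounds[OF x, of n] conv_error_pos[OF x, of "Suc n"]
      by (intro mult_right_mono) (auto simp: a_def q_def t_def)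
    also have "\<dots> \<le> 1" unfolding t_def by (rule conv_denom_error_le_1[OF x])
    finally have "a \<le> 1 / c" using c(1) by (simp add: field_simps)
    then show ?thesis using a unfolding a_def by linarith
  qed
  have "\<bar>partial_quotient x n\<bar> \<le> max \<bar>partial_quotient x 0\<bar> \<lceil>1 / c\<rceil>" for n
    using bound by (cases n) (auto simp: max.coboundedI2)
  then show ?thesis unfolding bounded_partial_quotients_def by blast
qed

text \<open>For \<open>m > 0\<close> compare \<open>m * x - p\<close> with the first convergent error \<open>t\<close> such that \<open>m * t \<le> 1/2\<close>.
  If \<open>p / m\<close> differs from that convergent \<open>p' / q\<close>, then the nonzero integer \<open>m * p' - q * p\<close> is at most
  \<open>m * t + q * \<bar>m * x - p\<bar>\<close> in absolute value; otherwise \<open>q * \<bar>m * x - p\<bar> = m * t\<close>.\<close>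

lemma badly_approximable_if_bounded_partial_quotients:
  assumes x: "x \<notin> \<rat>" and "bounded_partial_quotients x"
  shows "badly_approximable x"
proof -
  obtain B where B: "\<And>n. \<bar>partial_quotient x n\<bar> \<le> B"
    using assms(2) unfolding bounded_partial_quotients_def by blast
  have B0: "0 \<le> B" using B[of 0] by linarith
  define c where "c = 1 / (4 * (real_of_int B + 1))"
  have c: "0 < c" "c \<le> 1 / 4" using B0 by (simp_all add: c_def field_simps)
  have "c \<le> real m * \<bar>real m * x - of_int p\<bar>" if m: "m > 0" for m :: nat and p :: int
  proof -
    obtain k where "(1 / 2) ^ k < 1 / (2 * real m)"
      using m real_arch_pow_inv[of "1 / (2 * real m)" "1 / 2"] by auto
    then have "real m * conv_error x (2 * k) \<le> 1 / 2"
    proof -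
      have "conv_error x (2 * k) \<le> 1 / (2 * real m)"
        using conv_error_even_le[OF x, of k] \<open>(1 / 2) ^ k < 1 / (2 * real m)\<close> by linarith
      then show ?thesis using m by (simp add: field_simps)
    qed
    then have ex: "\<exists>n. real m * conv_error x n \<le> 1 / 2" by blast
    define l where "l = (LEAST n. real m * conv_error x n \<le> 1 / 2)"
    have l: "real m * conv_error x l \<le> 1 / 2" unfolding l_def by (rule LeastI_ex[OF ex])
    have "l \<noteq> 0"
      by (rule notI) (use l m in \<open>simp add: conv_error_def\<close>)
    then obtain n where n: "l = Suc n" by (cases l) auto
    have l': "1 / 2 < real m * conv_error x n"
      using not_less_Least[of n "\<lambda>n. real m * conv_error x n \<le> 1 / 2"] n unfolding l_def by linarith
    define q where "q = real_of_int (conv_denom x (Suc n))"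
    define t where "t = conv_error x (Suc n)"
    define e where "e = \<bar>real m * x - of_int p\<bar>"
    have q1: "1 \<le> q" using conv_denom_bounds[OF x, of n] by (simp add: q_def)
    \<comment> \<open>By minimality of \<open>l\<close> the previous error is too large for
      \<open>m\<close>, which keeps the denominator \<open>q\<close> below
      \<open>2 * m\<close>.\<close>
    have "q * conv_error x n < 2 * real m * conv_error x n"
      using conv_denom_error_le_1[OF x, of n] l' unfolding q_def by linarith
    then have q2: "q < 2 * real m" using conv_error_pos[OF x, of n] by simp
    define D where "D = int m * conv_numer x (Suc n) - conv_denom x (Suc n) * p"
    have D: "real_of_int D = q * (real m * x - of_int p) - real m * (q * x - of_int (conv_numer x (Suc n)))"
      by (simp add: D_def q_def algebra_simps)
    have t: "t = \<bar>q * x - of_int (conv_numer x (Suc n))\<bar>"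
      using abs_conv_error[OF x, of "Suc n"] by (simp add: q_def t_def)
    show ?thesis
    proof (cases "D = 0")
      case True
      have "q * e = \<bar>q * (real m * x - of_int p)\<bar>" using q1 by (simp add: e_def abs_mult)
      also have "\<dots> = real m * t" using True D by (simp add: t abs_mult)
      finally have eq: "q * e = real m * t" .
      \<comment> \<open>The bound \<open>B\<close> enters here: the error shrinks by a factor of at
        most \<open>B + 1\<close> in one step, so \<open>m * t\<close> cannot be far below
        \<open>1/2\<close>.\<close>
      have "complete_quotient x (Suc n) < of_int (partial_quotient x (Suc n)) + 1"
        unfolding partial_quotient_def by linarith
      also have "\<dots> \<le> of_int B + 1" using B[of "Suc n"] by linarith
      finally have cq: "complete_quotient x (Suc n) \<le> of_int B + 1" by simp
      have "1 / 2 < real m * t * complete_quotient x (Suc n)"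
        using l' conv_error_eq_Suc_mult[OF x, of n] by (simp add: t_def mult.assoc)
      also have "\<dots> \<le> real m * t * (of_int B + 1)"
        using cq conv_error_pos[OF x, of "Suc n"] by (intro mult_left_mono) (auto simp: t_def)
      finally have "2 * c \<le> real m * t" using B0 by (simp add: c_def field_simps)
      also have "\<dots> = q * e" by (simp add: eq)
      also have "\<dots> \<le> 2 * real m * e" using q2 by (intro mult_right_mono) (auto simp: e_def)
      finally show ?thesis by (simp add: e_def)
    next
      case False
      then have "1 \<le> \<bar>real_of_int D\<bar>" by linarith
      also have "\<dots> \<le> \<bar>q * (real m * x - of_int p)\<bar> + \<bar>real m * (q * x - of_int (conv_numer x (Suc n)))\<bar>"
        unfolding D by (rule abs_triangle_ineq4)
      also have "\<dots> = q * e + real m * t" using q1 by (simp add: e_def t abs_mult)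
      also have "\<dots> \<le> q * e + 1 / 2" using l n by (simp add: t_def)
      finally have "1 / 2 \<le> q * e" by simp
      also have "\<dots> \<le> 2 * real m * e" using q2 by (intro mult_right_mono) (auto simp: e_def)
      finally show ?thesis using c by (simp add: e_def)
    qed
  qed
  then show ?thesis using c(1) unfolding badly_approximable_def by blast
qed

section \<open>Distribution of the orbit of a rotation\<close>

lemma irrational_orbit_dense:
  fixes x a b \<rho> :: real
  assumes "x \<notin> \<rat>" "a < b"
  obtains n :: nat and v :: int where "a < \<rho> + real n * x - of_int v" "\<rho> + real n * x - of_int v < b"
proof -
  obtain h k :: int where "k > 0" "\<bar>of_int k * x - of_int h - ((a + b) / 2 - \<rho>)\<bar> < (b - a) / 2"
    using sequence_of_fractional_parts_is_dense[OF assms(1), of "(b - a) / 2"] assms(2)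
    by (metis diff_gt_0_iff_gt half_gt_zero)
  then have "\<bar>\<rho> + real (nat k) * x - of_int h - (a + b) / 2\<bar> < (b - a) / 2"
    by (simp add: algebra_simps)
  then have "a < \<rho> + real (nat k) * x - of_int h" "\<rho> + real (nat k) * x - of_int h < b"
    unfolding abs_less_iff by (simp_all add: field_simps)
  then show ?thesis by (rule that)
qed

text \<open>A Dirichlet approximation \<open>h / k\<close> of level \<open>N\<close> has \<open>k > c * N\<close>, so the first \<open>k\<close> orbit points are
  within \<open>1 / N\<close> of a full set of multiples of \<open>1 / k\<close>.\<close>

lemma badly_approximable_orbit_return:
  assumes "badly_approximable x"
  obtains K where "K > 0"
    "\<And>y \<eta>. 0 < \<eta> \<Longrightarrow> \<eta> \<le> 1 \<Longrightarrow> \<exists>j v. real j \<le> K / \<eta> \<and> \<bar>y + real j * x - of_int (v::int)\<bar> < \<eta>"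
proof -
  obtain c where c: "c > 0"
    "\<And>(m::nat) (p::int). m > 0 \<Longrightarrow> c \<le> real m * \<bar>real m * x - of_int p\<bar>"
    using assms unfolding badly_approximable_def by blast
  \<comment> \<open>The summand 1 pays for the approximation error \<open>1 / N\<close>, the summand
    \<open>1 / c\<close> for rounding to a multiple of \<open>1 / k\<close>, where
    \<open>k > c * N\<close>.\<close>
  define A where "A = 1 + 1 / c"
  have A: "A \<ge> 1" using c by (simp add: A_def)
  have main: "\<exists>j v. real j \<le> (A + 1) / \<eta> \<and> \<bar>y + real j * x - of_int (v::int)\<bar> < \<eta>"
    if \<eta>: "0 < \<eta>" "\<eta> \<le> 1" for y \<eta>
  proof -
    define N where "N = nat \<lceil>A / \<eta>\<rceil>"
    have "0 < A / \<eta>" using A \<eta> by simp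
    then have N: "A / \<eta> \<le> real N" "real N < A / \<eta> + 1" "N > 0" unfolding N_def by linarith+
    have "A \<le> real N * \<eta>" using N(1) \<eta>(1) by (simp add: field_simps)
    have "1 \<le> 1 / \<eta>" using \<eta> by simp
    then have N': "real N \<le> (A + 1) / \<eta>" using N(2) by (simp add: add_divide_distrib)
    obtain h k where hk: "coprime h k" "0 < k" "k \<le> int N" "\<bar>of_int k * x - of_int h\<bar> < 1 / N"
      using Dirichlet_approx_coprime[OF N(3), of x] by blast
    have "c \<le> of_int k * \<bar>of_int k * x - of_int h\<bar>" using c(2)[of "nat k" h] hk(2) by simp
    also have "\<dots> < of_int k * (1 / N)" using hk by (intro mult_strict_left_mono) auto
    finally have cN: "c * N < of_int k" using N by (simp add: field_simps)
    define u where "u = round (- y * of_int k)"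
    have u: "\<bar>of_int u - (- y * of_int k)\<bar> \<le> 1 / 2" unfolding u_def by (rule of_int_round_abs_le)
    \<comment> \<open>\<open>r\<close> inverts \<open>h\<close> modulo \<open>k\<close>, so the
      \<open>j\<close> defined next solves \<open>h * j = u\<close> modulo \<open>k\<close> with
      \<open>j < k\<close>.\<close>
    obtain r r' where r: "r * h + r' * k = 1" using bezout_int[of h k] hk(1) by auto
    define j where "j = nat ((r * u) mod k)"
    have j: "int j = (r * u) mod k" "int j < k" using hk(2) by (auto simp: j_def)
    have jk: "real j \<le> of_int k" using j(2) by linarith
    define v where "v = - (r' * u + h * ((r * u) div k))"
    have "h * int j = (r * h) * u - k * (h * ((r * u) div k))"
      unfolding j by (simp add: minus_div_mult_eq_mod[symmetric] algebra_simps)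
    also have "r * h = 1 - r' * k" using r by simp
    finally have v: "h * int j = u + k * v" by (simp add: v_def algebra_simps)
    have rv: "of_int h * real j = of_int u + of_int k * real_of_int v"
      using arg_cong[OF v, of real_of_int] by simp
    have kpos: "0 < real_of_int k" using hk(2) by simp
    have "of_int k * (y + real j * x - of_int v) =
        real j * (of_int k * x - of_int h) + (of_int u - (- y * of_int k))"
      using rv by (simp add: algebra_simps)
    then have "of_int k * \<bar>y + real j * x - of_int v\<bar> =
        \<bar>real j * (of_int k * x - of_int h) + (of_int u - (- y * of_int k))\<bar>"
      using kpos by (metis abs_mult abs_of_pos)
    also have "\<dots> \<le> real j * \<bar>of_int k * x - of_int h\<bar> + 1 / 2"
      using u abs_triangle_ineq[of "real j * (of_int k * x - of_int h)" "of_int u - (- y * of_int k)"]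
      by (simp add: abs_mult)
    also have "\<dots> \<le> of_int k * (1 / N) + 1 / 2"
      using jk hk by (intro add_right_mono mult_mono) auto
    also have "\<dots> < of_int k * (1 / N) + 1" by simp
    also have "\<dots> < of_int k * (1 / N) + of_int k / (c * N)"
      using cN c N by (simp add: field_simps)
    also have "\<dots> = of_int k * (A / N)" by (simp add: A_def distrib_left add_divide_distrib)
    also have "\<dots> \<le> of_int k * \<eta>"
      using kpos N(3) \<open>A \<le> real N * \<eta>\<close> by (intro mult_left_mono) (auto simp: field_simps)
    finally have "\<bar>y + real j * x - of_int v\<bar> < \<eta>" using kpos by simp
    moreover have "real j \<le> (A + 1) / \<eta>" using jk hk(3) N' by linarith
    ultimately show ?thesis by blast
  qed
  show ?thesis using A by (intro that[OF _ main]) auto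
qed

section \<open>Sturmian words as differences of a rounding function\<close>

text \<open>One interface for both interval conventions: \<open>floor\<close> belongs to
  \<open>sturmian_left\<close>, \<open>ceiling\<close> to \<open>sturmian_right\<close>.\<close>

locale sturmian_coding =
  fixes \<alpha> \<rho> :: real and s :: "nat \<Rightarrow> letter" and G :: "real \<Rightarrow> int"
  assumes \<alpha>_pos: "0 < \<alpha>" and \<alpha>_less_1: "\<alpha> < 1" and irrational: "\<alpha> \<notin> \<rat>"
    and G_cases: "G = floor \<or> G = ceiling"
    and s_eq: "s n = (if G (\<rho> + real (Suc n) * \<alpha>) = G (\<rho> + real n * \<alpha>) + 1 then La else Lb)"
begin

abbreviation x :: "nat \<Rightarrow> real" where
  "x n \<equiv> \<rho> + real n * \<alpha>"

lemma G_diff: "\<bar>of_int (G y) - of_int (G z) - (y - z)\<bar> < 1"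
  using G_cases by (elim disjE; simp; linarith)

lemma G_add_int: "G (y + of_int k) = G y + k"
  using G_cases by auto

text \<open>The closed segment must avoid the integers because \<open>floor\<close> jumps on
  reaching an integer and \<open>ceiling\<close> on leaving it; \<open>G_less\<close> has strict
  inequalities for the same reason.\<close>

lemma G_eqI:
  assumes "\<And>v::int. \<not> (min y z \<le> of_int v \<and> of_int v \<le> max y z)"
  shows "G y = G z"
proof -
  have *: "G y = G z" if "y \<le> z" and n: "\<And>v::int. \<not> (y \<le> of_int v \<and> of_int v \<le> z)" for y z
    using G_cases
  proof
    assume "G = floor"
    then show ?thesis using n[of "\<lfloor>z\<rfloor>"] that(1) by simp linarith
  next
    assume "G = ceiling"
    then show ?thesis using n[of "\<lceil>y\<rceil>"] that(1) by simp linarith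
  qed
  show ?thesis
  proof (cases "y \<le> z")
    case True
    then show ?thesis using assms by (intro *) (simp_all only: min_absorb1 max_absorb2 not_False_eq_True)
  next
    case False
    then have "z \<le> y" by simp
    then show ?thesis using assms
      by (intro *[symmetric]) (simp_all only: min_absorb2 max_absorb1 not_False_eq_True)
  qed
qed

lemma G_less:
  assumes "y < of_int v" "of_int v < z"
  shows "G y < G z"
  using G_cases
proof
  assume "G = floor"
  moreover have "\<lfloor>y\<rfloor> < v" "v \<le> \<lfloor>z\<rfloor>" using assms by (simp_all add: floor_less_iff le_floor_iff)
  ultimately show ?thesis by simp
next
  assume "G = ceiling"
  moreover have "\<lceil>y\<rceil> \<le> v" "v < \<lceil>z\<rceil>" using assms by (simp_all add: ceiling_le_iff less_ceiling_iff)
  ultimately show ?thesis by simp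
qed

lemma G_step: "G (x (Suc n)) = G (x n) + (if s n = La then 1 else 0)"
proof -
  have "x (Suc n) - x n = \<alpha>" by (simp add: algebra_simps)
  then have "G (x (Suc n)) = G (x n) \<or> G (x (Suc n)) = G (x n) + 1"
    using G_diff[of "x (Suc n)" "x n"] \<alpha>_pos \<alpha>_less_1 by linarith
  then show ?thesis using s_eq[of n] by auto
qed

lemma count_La: "int (count_list (map s [i..<i + n]) La) = G (x (i + n)) - G (x i)"
  by (induction n) (use G_step in \<open>auto simp del: of_nat_Suc\<close>)

section \<open>Abelian powers and bad approximability\<close>

text \<open>The power contains \<open>k * fst P\<close> letters \<open>La\<close>, and by
  \<open>G_diff\<close> this count differs from \<open>k * m * \<alpha>\<close> by less than
  1.\<close>

lemma abelian_power_bound: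
  assumes "factor w s" "abelian_power m k w"
  obtains P :: int where "real k * \<bar>real m * \<alpha> - of_int P\<bar> < 1"
proof -
  obtain us P where us: "w = concat us" "length us = k" "\<forall>u\<in>set us. length u = m \<and> parikh u = P"
    using assms(2) unfolding abelian_power_def by blast
  have len: "length w = k * m" using us length_concat_const by blast
  have "\<forall>u\<in>set us. count_list u La = fst P" using us(3) by (metis fst_conv parikh_def)
  then have "count_list (concat us) La = length us * fst P" by (induction us) auto
  then have cnt: "count_list w La = k * fst P" using us by simp
  obtain i where i: "w = map s [i..<i + length w]" using assms(1) unfolding factor_def by blast
  have "int (k * fst P) = G (x (i + k * m)) - G (x i)"
    using count_La[of i "k * m"] cnt unfolding i[unfolded len, symmetric] by simp
  then have "of_int (G (x (i + k * m))) - of_int (G (x i)) = real k * real (fst P)"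
    by (metis of_int_diff of_int_of_nat_eq of_nat_mult)
  then have "\<bar>real k * real (fst P) - (x (i + k * m) - x i)\<bar> < 1"
    using G_diff[of "x (i + k * m)" "x i"] by simp
  also have "real k * real (fst P) - (x (i + k * m) - x i) = - (real k * (real m * \<alpha> - of_int (int (fst P))))"
    by (simp add: algebra_simps)
  finally show ?thesis by (intro that[of "int (fst P)"]) (simp only: abs_minus_cancel abs_mult abs_of_nat)
qed

lemma abelian_powerI:
  assumes "m > 0" "k > 0"
    and P: "\<And>j. j < k \<Longrightarrow> G (x (i + j * m + m)) - G (x (i + j * m)) = P"
  shows "factor (map s [i..<i + k * m]) s" "abelian_power m k (map s [i..<i + k * m])"
proof -
  show "factor (map s [i..<i + k * m]) s" unfolding factor_def by auto
  define us where "us = map (\<lambda>j. map s [i + j * m..<i + j * m + m]) [0..<k]"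
  have "concat (map (\<lambda>j. map s [i + j * m..<i + j * m + m]) [0..<n]) = map s [i..<i + n * m]" for n
  proof (induction n)
    case (Suc n)
    have "[i..<i + Suc n * m] = [i..<i + n * m] @ [i + n * m..<i + n * m + m]"
      using upt_add_eq_append[of i "i + n * m" m] by (simp add: algebra_simps)
    then show ?case using Suc by simp
  qed simp
  then have "map s [i..<i + k * m] = concat us" unfolding us_def by simp
  moreover have "length u = m \<and> parikh u = (nat P, m - nat P)" if u: "u \<in> set us" for u
  proof -
    obtain j where j: "j < k" "u = map s [i + j * m..<i + j * m + m]"
      using u unfolding us_def by auto
    then have "length u = m" "count_list u La = nat P"
      using count_La[of "i + j * m" m] P[of j] by auto
    moreover have "length u = count_list u La + count_list u Lb"
      using length_eq_parikh_norm[of u] by (simp add: parikh_norm_def parikh_def)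
    ultimately show ?thesis by (simp add: parikh_def)
  qed
  ultimately show "abelian_power m k (map s [i..<i + k * m])"
    unfolding abelian_power_def using assms(1,2)
    by (intro conjI exI[of _ us] exI[of _ "(nat P, m - nat P)"]) (auto simp: us_def)
qed

text \<open>Modulo 1, the starts of successive blocks move by \<open>\<delta>\<close>. Their total
  displacement is less than 1, so by density some starting point keeps all of them between two
  consecutive integers.\<close>

lemma abelian_power_exists:
  assumes "m > 0" "k > 0" "real k * \<bar>real m * \<alpha> - of_int P\<bar> < 1"
  shows "\<exists>w. factor w s \<and> abelian_power m k w"
proof -
  define \<delta> where "\<delta> = real m * \<alpha> - of_int P"
  \<comment> \<open>This is the set of \<open>y\<close> such that \<open>y\<close> and
    \<open>y + k * \<delta>\<close> both lie strictly between 0 and 1.\<close>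
  have less: "max 0 (- (real k * \<delta>)) < min 1 (1 - real k * \<delta>)"
  proof -
    have "\<bar>real k * \<delta>\<bar> < 1" using assms(3) by (simp add: \<delta>_def abs_mult)
    then show ?thesis by (auto simp: max_def min_def abs_if split: if_splits)
  qed
  obtain i v where iv: "max 0 (- (real k * \<delta>)) < x i - of_int v" "x i - of_int v < min 1 (1 - real k * \<delta>)"
    using irrational_orbit_dense[OF irrational less, of \<rho>] by blast
  have const: "G (x i + real j * \<delta>) = G (x i)" if "j \<le> k" for j
  proof (rule G_eqI)
    fix w :: int
    have "real j * \<delta> \<in> {min 0 (real k * \<delta>)..max 0 (real k * \<delta>)}"
    proof (cases "\<delta> \<ge> 0")
      case True
      then have "0 \<le> real j * \<delta>" "real j * \<delta> \<le> real k * \<delta>" using that by (auto intro: mult_right_mono)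
      then show ?thesis by auto
    next
      case False
      then have "real j * \<delta> \<le> 0" "real k * \<delta> \<le> real j * \<delta>"
        using that by (auto intro: mult_right_mono_neg mult_nonneg_nonpos)
      then show ?thesis by auto
    qed
    then have "of_int v < x i" "x i < of_int v + 1" "of_int v < x i + real j * \<delta>" "x i + real j * \<delta> < of_int v + 1"
      using iv by (auto simp: min_def max_def split: if_splits)
    then have "of_int v < min (x i + real j * \<delta>) (x i)" "max (x i + real j * \<delta>) (x i) < of_int (v + 1)"
      by simp_all
    then show "\<not> (min (x i + real j * \<delta>) (x i) \<le> of_int w \<and> of_int w \<le> max (x i + real j * \<delta>) (x i))"
      by (metis less_le_trans le_less_trans of_int_less_iff less_le_not_le zless_add1_eq)
  qed
  have eq: "x (i + j * m) = x i + real j * \<delta> + of_int (int j * P)" for j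
    by (simp add: \<delta>_def algebra_simps)
  have G: "G (x (i + j * m)) = G (x i) + int j * P" if "j \<le> k" for j
    unfolding eq G_add_int const[OF that] by simp
  have "G (x (i + j * m + m)) - G (x (i + j * m)) = P" if "j < k" for j
    using G[of "Suc j"] G[of j] that by (simp add: algebra_simps)
  then show ?thesis using abelian_powerI[OF assms(1,2)] by blast
qed

lemma abelian_critical_exponent_finite_if_badly_approximable:
  assumes "badly_approximable \<alpha>"
  shows "abelian_critical_exponent s < \<infinity>"
proof -
  obtain c where c: "c > 0"
    "\<And>(m::nat) (p::int). m > 0 \<Longrightarrow> c \<le> real m * \<bar>real m * \<alpha> - of_int p\<bar>"
    using assms unfolding badly_approximable_def by blast
  have "abelian_power_exp s m / of_nat m \<le> ennreal (1 / c)" if m: "m > 0" for m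
  proof -
    have "abelian_power_exp s m \<le> ennreal (real m / c)"
      unfolding abelian_power_exp_def
    proof (rule Sup_least, clarify)
      fix k w assume "factor w s" "abelian_power m k w"
      then obtain P :: int where P: "real k * \<bar>real m * \<alpha> - of_int P\<bar> < 1"
        by (rule abelian_power_bound)
      have "real k * c \<le> real m * (real k * \<bar>real m * \<alpha> - of_int P\<bar>)"
        using mult_left_mono[OF c(2)[OF m, of P], of "real k"] by (simp add: algebra_simps)
      also have "\<dots> \<le> real m * 1" using P by (intro mult_left_mono) auto
      finally show "of_nat k \<le> ennreal (real m / c)"
        using c(1) by (simp add: ennreal_of_nat_eq_real_of_nat ennreal_leI field_simps)
    qed
    then have "abelian_power_exp s m / of_nat m \<le> ennreal (real m / c) / of_nat m"
      by (rule divide_right_mono_ennreal)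
    also have "\<dots> = ennreal (1 / c)"
      using m c(1) by (simp add: ennreal_of_nat_eq_real_of_nat divide_ennreal)
    finally show ?thesis .
  qed
  then have "abelian_critical_exponent s \<le> ennreal (1 / c)"
    unfolding abelian_critical_exponent_def
    by (intro Limsup_bounded eventually_mono[OF eventually_gt_at_top[of 0]]) auto
  then show ?thesis using ennreal_less_top by (simp add: order_le_less_trans)
qed

lemma mult_\<alpha>_neq_int: "m > 0 \<Longrightarrow> real m * \<alpha> \<noteq> of_int p"
  using irrational Rats_divide[OF Rats_of_int Rats_of_nat, of p m]
  by (metis nonzero_mult_div_cancel_left of_nat_eq_0_iff less_numeral_extra(3))

text \<open>If \<open>d\<close> is the distance from \<open>m * \<alpha>\<close> to
  \<open>p\<close>, an exponent close to \<open>1 / d\<close> is attained; a linear bound on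
  exponents therefore bounds \<open>m * d\<close> from below.\<close>

lemma badly_approximable_if_abelian_critical_exponent_finite:
  assumes "abelian_critical_exponent s < \<infinity>"
  shows "badly_approximable \<alpha>"
proof -
  obtain C where C: "abelian_critical_exponent s < ennreal C" "C > 0"
  proof -
    obtain r where r: "abelian_critical_exponent s = ennreal r" "0 \<le> r"
      using assms by (cases "abelian_critical_exponent s") auto
    then show ?thesis using that[of "r + 1"] by (simp add: ennreal_lessI)
  qed
  have "\<forall>\<^sub>F m in sequentially. abelian_power_exp s m / of_nat m < ennreal C"
    using C(1) unfolding abelian_critical_exponent_def by (rule Limsup_lessD)
  then obtain M where M: "\<And>m. m \<ge> M \<Longrightarrow> abelian_power_exp s m / of_nat m < ennreal C"
    unfolding eventually_sequentially by blast
  have large: "1 / (C + 1) \<le> real m * \<bar>real m * \<alpha> - of_int p\<bar>" if m: "m \<ge> M" "m > 0" for m p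
  proof -
    define d where "d = \<bar>real m * \<alpha> - of_int p\<bar>"
    have d: "0 < d" using mult_\<alpha>_neq_int[OF m(2), of p] by (simp add: d_def)
    \<comment> \<open>The largest integer strictly below \<open>1 / d\<close>. It may be 0, which
      \<open>abelian_power\<close> excludes, hence the case distinction.\<close>
    define k where "k = nat (\<lceil>1 / d\<rceil> - 1)"
    have k: "real k < 1 / d" "1 / d \<le> real k + 1" using d unfolding k_def by (simp_all add: of_nat_nat) linarith+
    have "real k \<le> C * real m"
    proof (cases "k = 0")
      case False
      have "real k * d < 1" using k d by (simp add: field_simps)
      then obtain w where "factor w s" "abelian_power m k w"
        using abelian_power_exists[of m k p] m False by (auto simp: d_def)
      then have "of_nat k \<le> abelian_power_exp s m"
        unfolding abelian_power_exp_def by (intro Sup_upper) blast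
      then have "of_nat k / of_nat m \<le> abelian_power_exp s m / of_nat m"
        by (rule divide_right_mono_ennreal)
      also have "\<dots> < ennreal C" using M m by blast
      finally have "ennreal (real k / real m) < ennreal C"
        using m by (simp add: ennreal_of_nat_eq_real_of_nat divide_ennreal)
      then show ?thesis using m C(2) by (simp add: ennreal_less_iff field_simps)
    qed (use C in simp)
    then have "1 / d \<le> C * real m + 1" using k by linarith
    also have "\<dots> \<le> (C + 1) * real m" using m by (simp add: algebra_simps)
    finally have "1 \<le> (C + 1) * real m * d" using d by (simp add: field_simps)
    then show ?thesis using C(2) by (simp add: field_simps d_def)
  qed
  \<comment> \<open>The limsup controls only \<open>m \<ge> M\<close>; the finitely many smaller
    \<open>m\<close> contribute their distances to the nearest integer, positive by
    irrationality.\<close>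
  define D where "D = Min (insert (1 / (C + 1)) ((\<lambda>m. \<bar>real m * \<alpha> - of_int (round (real m * \<alpha>))\<bar>) ` {1..<M}))"
  have D0: "D > 0" unfolding D_def using C(2) mult_\<alpha>_neq_int by (subst Min_gr_iff) auto
  have "D \<le> real m * \<bar>real m * \<alpha> - of_int p\<bar>" if m: "m > 0" for m p
  proof (cases "m \<ge> M")
    case True
    then show ?thesis using large[OF True m, of p] unfolding D_def by (meson Min_le finite.insertI
          finite_atLeastLessThan finite_imageI insertI1 order_trans)
  next
    case False
    then have "D \<le> \<bar>real m * \<alpha> - of_int (round (real m * \<alpha>))\<bar>"
      unfolding D_def using m by (intro Min_le) auto
    also have "\<dots> \<le> \<bar>real m * \<alpha> - of_int p\<bar>" using round_diff_minimal by blast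
    also have "\<dots> \<le> real m * \<bar>real m * \<alpha> - of_int p\<bar>" using m mult_right_mono[of 1 "real m" "\<bar>real m * \<alpha> - of_int p\<bar>"] by simp
    finally show ?thesis .
  qed
  then show ?thesis unfolding badly_approximable_def using D0 by blast
qed

section \<open>Ordinary powers and bad approximability\<close>

text \<open>Equal letters mean equal increments of \<open>G\<close> at both positions. Here
  \<open>n = l\<close> is allowed, since \<open>l\<close> equal letters link \<open>l + 1\<close>
  differences.\<close>

lemma G_shift_const:
  assumes "\<And>n. i \<le> n \<Longrightarrow> n < i + l \<Longrightarrow> s n = s (n + p)" "n \<le> l"
  shows "G (x (i + n + p)) - G (x (i + n)) = G (x (i + p)) - G (x i)"
  using assms(2)
proof (induction n)
  case (Suc n)
  have "s (i + n) = s (i + n + p)" using Suc.prems by (intro assms(1)) auto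
  then show ?case using Suc G_step[of "i + n"] G_step[of "i + n + p"] by simp
qed simp

text \<open>A factor of length \<open>L\<close> and period \<open>p\<close> makes \<open>L - p + 1\<close> consecutive orbit points miss the interval
  of length \<open>\<bar>\<delta>\<bar>\<close> next to the integers, where \<open>\<delta>\<close> is the difference of \<open>p * \<alpha>\<close> and an integer.\<close>

lemma power_free_if_badly_approximable:
  assumes "badly_approximable \<alpha>"
  shows "\<exists>\<beta>\<ge>2. power_free \<beta> s"
proof -
  obtain c where c: "c > 0"
    "\<And>(m::nat) (p::int). m > 0 \<Longrightarrow> c \<le> real m * \<bar>real m * \<alpha> - of_int p\<bar>"
    using assms unfolding badly_approximable_def by blast
  obtain K where K: "K > 0"
    "\<And>y \<eta>. 0 < \<eta> \<Longrightarrow> \<eta> \<le> 1 \<Longrightarrow> \<exists>j v. real j \<le> K / \<eta> \<and> \<bar>y + real j * \<alpha> - of_int (v::int)\<bar> < \<eta>"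
    using badly_approximable_orbit_return[OF assms] by blast
  have bound: "real (length w) \<le> (1 + 2 * K / c) * real p"
    if w: "factor w s" and per: "has_period w p" for w :: "letter list" and p
  proof (cases "length w < p")
    case True
    have "1 * real p \<le> (1 + 2 * K / c) * real p" using K c by (intro mult_right_mono) auto
    then show ?thesis using True by linarith
  next
    case False
    obtain i where i: "w = map s [i..<i + length w]" using w unfolding factor_def by blast
    have p: "p > 0" using per unfolding has_period_def by blast
    define l where "l = length w - p"
    have s: "s n = s (n + p)" if "i \<le> n" "n < i + l" for n
    proof -
      have lt: "n - i + p < length w" using that by (simp add: l_def)
      then have "w ! (n - i) = w ! (n - i + p)" using per unfolding has_period_def by blast
      moreover have "w ! k = s (i + k)" if "k < length w" for k
        using arg_cong[OF i, of "\<lambda>v. v ! k"] that by simp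
      ultimately show ?thesis using lt that by simp
    qed
    define P where "P = G (x (i + p)) - G (x i)"
    define \<delta> where "\<delta> = real p * \<alpha> - of_int P"
    have \<delta>p: "c \<le> real p * \<bar>\<delta>\<bar>" unfolding \<delta>_def using c(2)[OF p] .
    then have \<delta>0: "0 < \<bar>\<delta>\<bar>" using c(1) by auto
    have \<delta>1: "\<bar>\<delta>\<bar> < 1"
    proof -
      have "\<bar>of_int P - real p * \<alpha>\<bar> < 1"
        using G_diff[of "x (i + p)" "x i"] by (simp add: P_def algebra_simps)
      then show ?thesis by (simp add: \<delta>_def abs_minus_commute)
    qed
    \<comment> \<open>Centring at the midpoint of the segment from \<open>x i\<close> to
      \<open>x i + \<delta>\<close> makes the returned integer lie strictly inside the segment
      translated by \<open>j * \<alpha>\<close>.\<close>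
    obtain j v where jv: "real j \<le> K / (\<bar>\<delta>\<bar> / 2)" "\<bar>(x i + \<delta> / 2) + real j * \<alpha> - of_int (v::int)\<bar> < \<bar>\<delta>\<bar> / 2"
      using K(2)[of "\<bar>\<delta>\<bar> / 2" "x i + \<delta> / 2"] \<delta>0 \<delta>1 by auto
    have xij: "x (i + j) = x i + real j * \<alpha>" by (simp add: algebra_simps)
    have xijp: "x (i + j + p) = x (i + j) + \<delta> + of_int P" by (simp add: algebra_simps \<delta>_def)
    have "G (x (i + j) + \<delta>) \<noteq> G (x (i + j))"
    proof (cases "\<delta> > 0")
      case True
      then have "x (i + j) < of_int v" "of_int v < x (i + j) + \<delta>" using jv(2) unfolding xij by linarith+
      then show ?thesis using G_less by fastforce
    next
      case False
      then have "x (i + j) + \<delta> < of_int v" "of_int v < x (i + j)" using jv(2) unfolding xij by linarith+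
      then show ?thesis using G_less by fastforce
    qed
    then have "G (x (i + j + p)) - G (x (i + j)) \<noteq> P" unfolding xijp G_add_int by simp
    then have "l < j" using G_shift_const[of i l p j] s unfolding P_def by force
    then have "real l \<le> 2 * K / \<bar>\<delta>\<bar>" using jv(1) by (simp add: mult.commute)
    also have "\<dots> \<le> 2 * K / c * real p"
    proof -
      have "2 * K * c \<le> 2 * K * (real p * \<bar>\<delta>\<bar>)" using \<delta>p K by (intro mult_left_mono) auto
      then show ?thesis using \<delta>0 c(1) by (simp add: field_simps)
    qed
    finally have "real l \<le> 2 * K / c * real p" .
    moreover have "real (length w) = real p + real l" using False by (simp add: l_def)
    ultimately show ?thesis by (simp add: algebra_simps)
  qed
  define \<beta> where "\<beta> = 2 + 2 * K / c"
  have "word_exponent w < \<beta>" if w: "factor w s" for w :: "letter list"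
  proof -
    \<comment> \<open>A period longer than the word holds vacuously, so the minimum period exists
      even for the empty word.\<close>
    have "has_period w (Suc (length w))" by (simp add: has_period_def)
    then have per: "has_period w (LEAST p. has_period w p)" by (rule LeastI)
    then have "(LEAST p. has_period w p) > 0" unfolding has_period_def by blast
    then have "word_exponent w \<le> 1 + 2 * K / c"
      unfolding word_exponent_def using bound[OF w per] by (simp add: divide_le_eq)
    then show ?thesis by (simp add: \<beta>_def)
  qed
  moreover have "\<beta> \<ge> 2" using K c by (simp add: \<beta>_def)
  ultimately show ?thesis unfolding power_free_def by blast
qed

text \<open>Put \<open>\<delta> = m * \<alpha> - p\<close> and start at an orbit point within \<open>\<bar>\<delta>\<bar>\<close> of an integer, on the side towards which
  \<open>\<delta>\<close> points. If the segment from \<open>x (i + j)\<close> to \<open>x (i + j) + \<delta>\<close> contains an integer, then some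
  \<open>\<sigma> * (u - j * \<alpha>)\<close> lies in \<open>(0, 2 * \<bar>\<delta>\<bar>)\<close>, so \<open>\<sigma> * (m * u - j * p)\<close> is a positive integer less than
  \<open>(j + 2 * m) * \<bar>\<delta>\<bar>\<close>. Hence the period \<open>m\<close> persists as long as \<open>(j + 2 * m) * \<bar>\<delta>\<bar> \<le> 1\<close>.\<close>

lemma long_run:
  fixes m :: nat and p :: int
  defines "\<delta> \<equiv> real m * \<alpha> - of_int p"
  assumes "m > 0"
  obtains i where "\<And>j. (real j + 2 * real m) * \<bar>\<delta>\<bar> \<le> 1 \<Longrightarrow> G (x (i + j + m)) = G (x (i + j)) + p"
proof -
  \<comment> \<open>The sign of \<open>\<delta>\<close>, which lets both orientations share one
    computation.\<close>
  define \<sigma> :: int where "\<sigma> = (if \<delta> > 0 then 1 else -1)"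
  have \<delta>0: "\<delta> \<noteq> 0" using mult_\<alpha>_neq_int[OF assms(2), of p] by (simp add: \<delta>_def)
  have \<sigma>\<delta>: "of_int \<sigma> * \<delta> = \<bar>\<delta>\<bar>" by (simp add: \<sigma>_def)
  obtain i v where iv: "0 < of_int \<sigma> * (x i - of_int v)" "of_int \<sigma> * (x i - of_int v) < \<bar>\<delta>\<bar>"
  proof (cases "\<delta> > 0")
    case True
    obtain i v where "0 < x i - of_int v" "x i - of_int v < \<delta>"
      using irrational_orbit_dense[OF irrational True, of \<rho>] by blast
    then show ?thesis using that[of i v] True by (simp add: \<sigma>_def)
  next
    case False
    then have "\<delta> < 0" using \<delta>0 by simp
    from irrational_orbit_dense[OF irrational this, of \<rho>]
    obtain i v where "\<delta> < x i - of_int v" "x i - of_int v < 0" by blast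
    then show ?thesis using that[of i v] False by (simp add: \<sigma>_def)
  qed
  have "G (x (i + j + m)) = G (x (i + j)) + p" if j: "(real j + 2 * real m) * \<bar>\<delta>\<bar> \<le> 1" for j
  proof -
    have "G (x (i + j) + \<delta>) = G (x (i + j))"
    proof (rule G_eqI, rule notI)
      fix w :: int
      assume w: "min (x (i + j) + \<delta>) (x (i + j)) \<le> of_int w \<and> of_int w \<le> max (x (i + j) + \<delta>) (x (i + j))"
      have w': "0 \<le> of_int \<sigma> * (of_int w - x (i + j))" "of_int \<sigma> * (of_int w - x (i + j)) \<le> \<bar>\<delta>\<bar>"
        using w \<delta>0 by (auto simp: \<sigma>_def min_def max_def split: if_splits)
      define u where "u = w - v"
      have eq: "of_int \<sigma> * (of_int u - real j * \<alpha>) =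
          of_int \<sigma> * (of_int w - x (i + j)) + of_int \<sigma> * (x i - of_int v)"
        by (simp add: u_def algebra_simps)
      have u: "0 < of_int \<sigma> * (of_int u - real j * \<alpha>)" "of_int \<sigma> * (of_int u - real j * \<alpha>) < 2 * \<bar>\<delta>\<bar>"
        unfolding eq using w' iv by linarith+
      have D: "real_of_int (\<sigma> * (int m * u - int j * p)) =
          real m * (of_int \<sigma> * (of_int u - real j * \<alpha>)) + real j * \<bar>\<delta>\<bar>"
        unfolding \<sigma>\<delta>[symmetric] by (simp add: \<delta>_def algebra_simps)
      have "real m * (of_int \<sigma> * (of_int u - real j * \<alpha>)) < real m * (2 * \<bar>\<delta>\<bar>)"
        using u(2) assms(2) by simp
      then have "real_of_int (\<sigma> * (int m * u - int j * p)) < (real j + 2 * real m) * \<bar>\<delta>\<bar>"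
        unfolding D by (simp add: algebra_simps)
      then have "\<sigma> * (int m * u - int j * p) < 1" using j by linarith
      moreover have "0 < real_of_int (\<sigma> * (int m * u - int j * p))"
        unfolding D using mult_pos_pos[of "real m", OF _ u(1)] assms(2) by (intro add_pos_nonneg) auto
      ultimately show False by linarith
    qed
    then have "G (x (i + j) + \<delta> + of_int p) = G (x (i + j)) + p" unfolding G_add_int by simp
    moreover have "x (i + j) + \<delta> + of_int p = x (i + j + m)" by (simp add: \<delta>_def algebra_simps)
    ultimately show ?thesis by (simp only:)
  qed
  then show ?thesis by (rule that)
qed

text \<open>A small \<open>d\<close> gives, by \<open>long_run\<close>, a factor of period
  \<open>m\<close> and length about \<open>1 / d - m\<close>; its exponent is below
  \<open>\<beta>\<close>, so \<open>1 / d\<close> is at most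
  \<open>(\<beta> + 2) * m\<close>.\<close>

lemma badly_approximable_if_power_free:
  assumes \<beta>: "power_free \<beta> s" "\<beta> \<ge> 2"
  shows "badly_approximable \<alpha>"
proof -
  have "1 / (\<beta> + 2) \<le> real m * \<bar>real m * \<alpha> - of_int p\<bar>" if m: "m > 0" for m :: nat and p :: int
  proof -
    define d where "d = \<bar>real m * \<alpha> - of_int p\<bar>"
    have d: "0 < d" using mult_\<alpha>_neq_int[OF m, of p] by (simp add: d_def)
    show ?thesis
    proof (cases "2 * real m * d \<le> 1")
      case True
      obtain i where i: "\<And>j. (real j + 2 * real m) * d \<le> 1 \<Longrightarrow> G (x (i + j + m)) = G (x (i + j)) + p"
        using long_run[OF m, of p] unfolding d_def by blast
      define l where "l = nat \<lfloor>1 / d - 2 * real m\<rfloor>"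
      have "0 \<le> 1 / d - 2 * real m" using True d by (simp add: field_simps)
      then have l: "real l \<le> 1 / d - 2 * real m" "1 / d - 2 * real m < real l + 1" unfolding l_def by linarith+
      define w where "w = map s [i..<i + (l + m)]"
      have "G (x (i + j + m)) = G (x (i + j)) + p" if "j \<le> l" for j
      proof (rule i)
        have "real j + 2 * real m \<le> 1 / d" using that l by linarith
        then show "(real j + 2 * real m) * d \<le> 1" using d by (simp add: field_simps)
      qed
      note const = this
      have "s (i + j) = s (i + j + m)" if "j < l" for j
        using const[of j] const[of "Suc j"] that G_step[of "i + j"] G_step[of "i + j + m"]
        by (cases "s (i + j)"; cases "s (i + j + m)") auto
      then have per: "has_period w m"
        using m unfolding has_period_def w_def by (simp add: add.assoc)
      then have "(LEAST p. has_period w p) \<le> m" by (rule Least_le)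
      moreover have "has_period w (LEAST p. has_period w p)" using per by (rule LeastI)
      then have "(LEAST p. has_period w p) > 0" unfolding has_period_def by blast
      \<comment> \<open>The minimum period may be smaller than \<open>m\<close>, which only raises
        the exponent.\<close>
      ultimately have "real (length w) / real m \<le> word_exponent w"
        unfolding word_exponent_def by (intro divide_left_mono) auto
      also have "\<dots> < \<beta>"
      proof -
        have "factor w s" unfolding factor_def w_def by auto
        then show ?thesis using \<beta> unfolding power_free_def by blast
      qed
      finally have "real l + real m < \<beta> * real m" using m by (simp add: w_def field_simps)
      then have "1 / d \<le> (\<beta> + 2) * real m" using l m by (simp add: algebra_simps)
      then have "1 \<le> (\<beta> + 2) * (real m * d)" using d by (simp add: field_simps)
      then show ?thesis using \<beta>(2) by (simp add: d_def field_simps)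
    next
      case False
      have "1 / (\<beta> + 2) \<le> 1 / 2" using \<beta>(2) by (simp add: field_simps)
      then show ?thesis using False by (simp add: d_def)
    qed
  qed
  moreover have "0 < 1 / (\<beta> + 2)" using \<beta>(2) by simp
  ultimately show ?thesis unfolding badly_approximable_def by blast
qed

end

section \<open>From the interval coding to rounding functions\<close>

lemma sturmian_word_coding:
  assumes "0 < \<alpha>" "\<alpha> < 1" "\<alpha> \<notin> \<rat>" "sturmian_word \<alpha> s"
  obtains \<rho> G where "sturmian_coding \<alpha> \<rho> s G"
proof -
  obtain \<rho> where "s = sturmian_left \<alpha> \<rho> \<or> s = sturmian_right \<alpha> \<rho>"
    using assms(4) unfolding sturmian_word_def by blast
  then show ?thesis
  proof
    assume s: "s = sturmian_left \<alpha> \<rho>"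
    have *: "frac y \<in> {0..<1 - \<alpha>} \<longleftrightarrow> \<lfloor>y + \<alpha>\<rfloor> \<noteq> \<lfloor>y\<rfloor> + 1" for y
      using assms(1,2) by (simp add: frac_def) linarith
    have "sturmian_coding \<alpha> \<rho> s floor"
      by unfold_locales (use assms *[of "\<rho> + real _ * \<alpha>"] in \<open>auto simp: s sturmian_left_def algebra_simps\<close>)
    then show ?thesis by (rule that)
  next
    assume s: "s = sturmian_right \<alpha> \<rho>"
    have *: "frac y \<in> {0<..1 - \<alpha>} \<longleftrightarrow> \<lceil>y + \<alpha>\<rceil> \<noteq> \<lceil>y\<rceil> + 1" for y
    \<comment> \<open>At an integer \<open>y\<close> the fractional part 0 stands for the identified
      endpoint 1: it lies outside the interval for \<open>Lb\<close>, and \<open>ceiling\<close>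
      indeed jumps right after \<open>y\<close>.\<close>
    proof (cases "y = of_int \<lceil>y\<rceil>")
      case True
      then obtain c :: int where "y = of_int c" by blast
      then show ?thesis using assms(1,2) by (simp add: add.commute[of _ \<alpha>] ceiling_eq_iff)
    next
      case False
      then have c: "of_int \<lceil>y\<rceil> - 1 < y" "y < of_int \<lceil>y\<rceil>" by linarith+
      then have "\<lfloor>y\<rfloor> = \<lceil>y\<rceil> - 1" by (simp add: floor_eq_iff)
      then have "frac y = y - of_int \<lceil>y\<rceil> + 1" "0 < frac y" using c by (simp_all add: frac_def)
      moreover have "\<lceil>y + \<alpha>\<rceil> \<noteq> \<lceil>y\<rceil> + 1 \<longleftrightarrow> y + \<alpha> \<le> of_int \<lceil>y\<rceil>" using assms(1,2) by linarith
      ultimately show ?thesis by auto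
    qed
    have "sturmian_coding \<alpha> \<rho> s ceiling"
      by unfold_locales (use assms *[of "\<rho> + real _ * \<alpha>"] in \<open>auto simp: s sturmian_right_def algebra_simps\<close>)
    then show ?thesis by (rule that)
  qed
qed

theorem theorem5p13:
  fixes \<alpha> :: real and s :: "nat \<Rightarrow> letter"
  assumes "0 < \<alpha>" and "\<alpha> < 1" and "\<alpha> \<notin> \<rat>"
    and "sturmian_word \<alpha> s"
  shows "(abelian_critical_exponent s < \<infinity> \<longleftrightarrow> (\<exists>\<beta>\<ge>2. power_free \<beta> s)) \<and>
         ((\<exists>\<beta>\<ge>2. power_free \<beta> s) \<longleftrightarrow> bounded_partial_quotients \<alpha>)"
proof -
  obtain \<rho> G where "sturmian_coding \<alpha> \<rho> s G" using sturmian_word_coding[OF assms] .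
  then interpret sturmian_coding \<alpha> \<rho> s G .
  show ?thesis
    using abelian_critical_exponent_finite_if_badly_approximable
      badly_approximable_if_abelian_critical_exponent_finite
      power_free_if_badly_approximable badly_approximable_if_power_free
      bounded_partial_quotients_if_badly_approximable[OF irrational]
      badly_approximable_if_bounded_partial_quotients[OF irrational]
    by blast
qed

end
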